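(* Let $(M(c),\varphi,\xi,\eta,g)$ be a conformal Kenmotsu space form and let $\acute{M}$ be a CR-hypersurface of $M(c)$ whose shape operator $A$ is scalar. If the Lee vector field $\omega^{\sharp}$ is tangent to $\acute{M}$, then $\acute{M}$ is totally geodesic.
   Context: An almost contact metric structure $(\varphi,\xi,\eta,g)$ on a $(2n+1)$-dimensional smooth manifold $M$ consists of a $(1,1)$-tensor field $\varphi$, a vector field $\xi$, a 1-form $\eta$ and a Riemannian metric $g$ with $\varphi^2=-\mathrm{Id}+\eta\otimes\xi$, $\eta(\xi)=1$, $\varphi\xi=0$, $\eta\circ\varphi=0$, $g(\varphi X,\varphi Y)=g(X,Y)-\eta(X)\eta(Y)$, $\eta(X)=g(X,\xi)$. It is a Kenmotsu structure if $(\nabla_X\varphi)Y=-g(X,\varphi Y)\xi-\eta(Y)\varphi X$, with $\nabla$ the Levi-Civita connection of $g$. $(M,\varphi,\xi,\eta,g)$ is a conformal Kenmotsu manifold if there is a positive smooth function $f:M\to\mathbb{R}$ (fixed throughout) such that $(\varphi,\ \tilde\xi=e^{-f/2}\xi,\ \tilde\eta=e^{f/2}\eta,\ \tilde g=e^{f}g)$ is a Kenmotsu structure on $M$. It is a conformal Kenmotsu space form, denoted $M(c)$, if moreover this Kenmotsu structure has constant $\varphi$-holomorphic sectional curvature $c$, i.e. the $\tilde g$-sectional curvature of $\mathrm{span}\{X,\varphi X\}$ equals the constant $c$ for all nonzero $X$ orthogonal to $\tilde\xi$. The 1-form $\omega$ is $\omega(X)=X(f)$, and the Lee vector field is $\omega^{\sharp}=\mathrm{grad}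 f$ (gradient with respect to $g$). A CR-hypersurface of $M$ is a $2n$-dimensional embedded submanifold $\acute{M}$ such that $\xi$ is tangent to $\acute{M}$ and $T\acute{M}$ is an orthogonal direct sum of distributions $D\oplus D^{\perp}$ with $\varphi(D_p)\subset D_p$ and $\varphi(D^{\perp}_p)\subset T_p^{\perp}\acute{M}$ for all $p\in\acute M$. With $N$ a unit normal vector field of $\acute{M}$ and $U=-\varphi N$, one takes $D^{\perp}=\mathrm{span}\{U,\xi\}$ and $D$ its orthogonal complement in $T\acute{M}$. $A$ is the shape operator: $AX=-\nabla_XN$ for $X\in T\acute M$, where $\nabla$ is the Levi-Civita connection of $g$. $A$ is scalar if $AX=\lambda X$ for all $X\in T\acute{M}$, for some scalar function $\lambda$. Totally geodesic means $A=0$. *)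

theory Defs
  imports "HOL-Analysis.Analysis"
begin

section \<open>Smooth maps and smooth manifolds\<close>

fun times_differentiable_on ::
    "nat \<Rightarrow> ('e::real_normed_vector \<Rightarrow> 'b::real_normed_vector) \<Rightarrow> 'e set \<Rightarrow> bool" where
  "times_differentiable_on 0 F W \<longleftrightarrow> continuous_on W F"
| "times_differentiable_on (Suc k) F W \<longleftrightarrow>
     continuous_on W F \<and> (\<forall>x\<in>W. F differentiable (at x)) \<and>
     (\<forall>v. times_differentiable_on k (\<lambda>x. frechet_derivative F (at x) v) W)"

text \<open>\<open>C\<^sup>\<infinity>\<close> maps; only used for open \<open>W\<close>.\<close>

definition smooth_on :: "('e::real_normed_vector \<Rightarrow> 'b::real_normed_vector) \<Rightarrow> 'e set \<Rightarrow> bool" where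
  "smooth_on F W \<longleftrightarrow> (\<forall>k. times_differentiable_on k F W)"

text \<open>The points of the manifold form the whole type \<open>'a\<close>, which carries the topology; a chart
  consists of its domain and its coordinate map into a Euclidean space \<open>'e\<close>.\<close>

type_synonym ('a, 'e) chart = "'a set \<times> ('a \<Rightarrow> 'e)"

abbreviation cdom :: "('a, 'e) chart \<Rightarrow> 'a set" where "cdom c \<equiv> fst c"
abbreviation cmap :: "('a, 'e) chart \<Rightarrow> 'a \<Rightarrow> 'e" where "cmap c \<equiv> snd c"
abbreviation crange :: "('a, 'e) chart \<Rightarrow> 'e set" where "crange c \<equiv> cmap c ` cdom c"

definition cinv :: "('a, 'e) chart \<Rightarrow> 'e \<Rightarrow> 'a" where
  "cinv c = inv_into (cdom c) (cmap c)"

definition is_chart :: "('a::topological_space, 'e::euclidean_space) chart \<Rightarrow> bool" where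
  "is_chart c \<longleftrightarrow> open (cdom c) \<and> open (crange c) \<and>
     homeomorphism (cdom c) (crange c) (cmap c) (cinv c)"

definition transition :: "('a, 'e) chart \<Rightarrow> ('a, 'e) chart \<Rightarrow> 'e \<Rightarrow> 'e" where
  "transition c c' = cmap c' \<circ> cinv c"

definition compatible ::
    "('a::topological_space, 'e::euclidean_space) chart \<Rightarrow> ('a, 'e) chart \<Rightarrow> bool" where
  "compatible c c' \<longleftrightarrow> smooth_on (transition c c') (cmap c ` (cdom c \<inter> cdom c')) \<and>
     smooth_on (transition c' c) (cmap c' ` (cdom c \<inter> cdom c'))"

text \<open>Together with the type class constraints this says that \<open>'a\<close> is a second countable Hausdorff
  smooth manifold of dimension \<open>DIM('e)\<close>. The atlas need not be maximal.\<close>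

definition smooth_atlas ::
    "('a::{t2_space,second_countable_topology}, 'e::euclidean_space) chart set \<Rightarrow> bool" where
  "smooth_atlas A \<longleftrightarrow> (\<forall>c\<in>A. is_chart c) \<and> (\<Union>c\<in>A. cdom c) = UNIV \<and>
     (\<forall>c\<in>A. \<forall>c'\<in>A. compatible c c')"

definition coord_fun :: "('a \<Rightarrow> 'b) \<Rightarrow> ('a, 'e) chart \<Rightarrow> 'e \<Rightarrow> 'b" where
  "coord_fun f c x = f (cinv c x)"

definition smooth_fun ::
    "('a::topological_space, 'e::euclidean_space) chart set \<Rightarrow> ('a \<Rightarrow> real) \<Rightarrow> bool" where
  "smooth_fun A f \<longleftrightarrow> (\<forall>c\<in>A. smooth_on (coord_fun f c) (crange c))"

section \<open>Tensor fields\<close>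

text \<open>A tensor field is the family of its representatives in the charts of the atlas, subject to the
  usual transformation laws. A tangent vector at \<open>p\<close> is represented in a chart \<open>c\<close> by an
  element of \<open>'e\<close>; the values of a representative outside \<open>crange c\<close> are irrelevant.
  For instance \<open>\<phi> c x v\<close> is the representative in \<open>c\<close> of the image under \<open>\<phi>\<close> of the tangent
  vector with components \<open>v\<close> at the point with coordinates \<open>x\<close>.\<close>

type_synonym ('a, 'e) vfield = "('a, 'e) chart \<Rightarrow> 'e \<Rightarrow> 'e"
type_synonym ('a, 'e) oneform = "('a, 'e) chart \<Rightarrow> 'e \<Rightarrow> 'e \<Rightarrow> real"
type_synonym ('a, 'e) endofield = "('a, 'e) chart \<Rightarrow> 'e \<Rightarrow> 'e \<Rightarrow> 'e"
type_synonym ('a, 'e) bilfield = "('a, 'e) chart \<Rightarrow> 'e \<Rightarrow> 'e \<Rightarrow> 'e \<Rightarrow> real"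

definition jac :: "('a, 'e::real_normed_vector) chart \<Rightarrow> ('a, 'e) chart \<Rightarrow> 'e \<Rightarrow> 'e \<Rightarrow> 'e" where
  "jac c c' x v = frechet_derivative (transition c c') (at x) v"

definition vector_field ::
    "('a::topological_space, 'e::euclidean_space) chart set \<Rightarrow> ('a, 'e) vfield \<Rightarrow> bool" where
  "vector_field A X \<longleftrightarrow> (\<forall>c\<in>A. smooth_on (X c) (crange c)) \<and>
     (\<forall>c\<in>A. \<forall>c'\<in>A. \<forall>x\<in>cmap c ` (cdom c \<inter> cdom c').
        X c' (transition c c' x) = jac c c' x (X c x))"

definition one_form ::
    "('a::topological_space, 'e::euclidean_space) chart set \<Rightarrow> ('a, 'e) oneform \<Rightarrow> bool" where
  "one_form A \<theta> \<longleftrightarrow>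
     (\<forall>c\<in>A. (\<forall>x\<in>crange c. linear (\<theta> c x)) \<and> (\<forall>v. smooth_on (\<lambda>x. \<theta> c x v) (crange c))) \<and>
     (\<forall>c\<in>A. \<forall>c'\<in>A. \<forall>x\<in>cmap c ` (cdom c \<inter> cdom c'). \<forall>v.
        \<theta> c' (transition c c' x) (jac c c' x v) = \<theta> c x v)"

definition endo_field ::
    "('a::topological_space, 'e::euclidean_space) chart set \<Rightarrow> ('a, 'e) endofield \<Rightarrow> bool" where
  "endo_field A \<phi> \<longleftrightarrow>
     (\<forall>c\<in>A. (\<forall>x\<in>crange c. linear (\<phi> c x)) \<and> (\<forall>v. smooth_on (\<lambda>x. \<phi> c x v) (crange c))) \<and>
     (\<forall>c\<in>A. \<forall>c'\<in>A. \<forall>x\<in>cmap c ` (cdom c \<inter> cdom c'). \<forall>v.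
        \<phi> c' (transition c c' x) (jac c c' x v) = jac c c' x (\<phi> c x v))"

definition riemannian_metric ::
    "('a::topological_space, 'e::euclidean_space) chart set \<Rightarrow> ('a, 'e) bilfield \<Rightarrow> bool" where
  "riemannian_metric A g \<longleftrightarrow>
     (\<forall>c\<in>A. (\<forall>x\<in>crange c. bilinear (g c x) \<and> (\<forall>u v. g c x u v = g c x v u) \<and>
                          (\<forall>v. v \<noteq> 0 \<longrightarrow> g c x v v > 0)) \<and>
            (\<forall>u v. smooth_on (\<lambda>x. g c x u v) (crange c))) \<and>
     (\<forall>c\<in>A. \<forall>c'\<in>A. \<forall>x\<in>cmap c ` (cdom c \<inter> cdom c'). \<forall>u v.
        g c' (transition c c' x) (jac c c' x u) (jac c c' x v) = g c x u v)"

section \<open>Levi-Civita connection and curvature\<close>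

text \<open>Christoffel symbols of a metric \<open>G\<close> on an open subset of \<open>'e\<close>. Symmetry is torsion-freeness
  (coordinate vector fields commute), the second condition is \<open>\<nabla>G = 0\<close>.\<close>

definition christoffel ::
    "('e::euclidean_space \<Rightarrow> 'e \<Rightarrow> 'e \<Rightarrow> real) \<Rightarrow> 'e \<Rightarrow> 'e \<Rightarrow> 'e \<Rightarrow> 'e" where
  "christoffel G x = (THE \<Gamma>. bilinear \<Gamma> \<and> (\<forall>u v. \<Gamma> u v = \<Gamma> v u) \<and>
     (\<forall>w u v. frechet_derivative (\<lambda>y. G y u v) (at x) w = G x (\<Gamma> w u) v + G x u (\<Gamma> w v)))"

definition cov_deriv ::
    "('e::euclidean_space \<Rightarrow> 'e \<Rightarrow> 'e \<Rightarrow> real) \<Rightarrow> ('e \<Rightarrow> 'e) \<Rightarrow> ('e \<Rightarrow> 'e) \<Rightarrow> 'e \<Rightarrow> 'e" where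
  "cov_deriv G X Y x = frechet_derivative Y (at x) (X x) + christoffel G x (X x) (Y x)"

definition lie_bracket :: "('e::euclidean_space \<Rightarrow> 'e) \<Rightarrow> ('e \<Rightarrow> 'e) \<Rightarrow> 'e \<Rightarrow> 'e" where
  "lie_bracket X Y x = frechet_derivative Y (at x) (X x) - frechet_derivative X (at x) (Y x)"

definition curv :: "('e::euclidean_space \<Rightarrow> 'e \<Rightarrow> 'e \<Rightarrow> real) \<Rightarrow>
    ('e \<Rightarrow> 'e) \<Rightarrow> ('e \<Rightarrow> 'e) \<Rightarrow> ('e \<Rightarrow> 'e) \<Rightarrow> 'e \<Rightarrow> 'e" where
  "curv G X Y Z x = cov_deriv G X (cov_deriv G Y Z) x - cov_deriv G Y (cov_deriv G X Z) x
     - cov_deriv G (lie_bracket X Y) Z x"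

definition nabla ::
    "('a, 'e::euclidean_space) bilfield \<Rightarrow> ('a, 'e) vfield \<Rightarrow> ('a, 'e) vfield \<Rightarrow> ('a, 'e) vfield" where
  "nabla g X Y c x = cov_deriv (g c) (X c) (Y c) x"

text \<open>The curvature is tensorial, so tangent vectors may be extended by vector fields that are
  constant in the chart.\<close>

definition sectional_curvature ::
    "('a, 'e::euclidean_space) bilfield \<Rightarrow> ('a, 'e) chart \<Rightarrow> 'e \<Rightarrow> 'e \<Rightarrow> 'e \<Rightarrow> real" where
  "sectional_curvature g c x u v =
     g c x (curv (g c) (\<lambda>_. u) (\<lambda>_. v) (\<lambda>_. v) x) u /
     (g c x u u * g c x v v - (g c x u v)\<^sup>2)"

section \<open>Kenmotsu and conformal Kenmotsu structures\<close>

definition almost_contact_metric ::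
    "('a::topological_space, 'e::euclidean_space) chart set \<Rightarrow> ('a, 'e) endofield \<Rightarrow>
     ('a, 'e) vfield \<Rightarrow> ('a, 'e) oneform \<Rightarrow> ('a, 'e) bilfield \<Rightarrow> bool" where
  "almost_contact_metric A \<phi> \<xi> \<eta> g \<longleftrightarrow>
     endo_field A \<phi> \<and> vector_field A \<xi> \<and> one_form A \<eta> \<and> riemannian_metric A g \<and>
     (\<forall>c\<in>A. \<forall>x\<in>crange c.
        (\<forall>u. \<phi> c x (\<phi> c x u) = - u + \<eta> c x u *\<^sub>R \<xi> c x) \<and>
        \<eta> c x (\<xi> c x) = 1 \<and>
        \<phi> c x (\<xi> c x) = 0 \<and>
        (\<forall>u. \<eta> c x (\<phi> c x u) = 0) \<and>
        (\<forall>u v. g c x (\<phi> c x u) (\<phi> c x v) = g c x u v - \<eta> c x u * \<eta> c x v) \<and>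
        (\<forall>u. \<eta> c x u = g c x u (\<xi> c x)))"

definition apply_endo :: "('a, 'e) endofield \<Rightarrow> ('a, 'e) vfield \<Rightarrow> ('a, 'e) vfield" where
  "apply_endo \<phi> Y c x = \<phi> c x (Y c x)"

definition kenmotsu ::
    "('a::topological_space, 'e::euclidean_space) chart set \<Rightarrow> ('a, 'e) endofield \<Rightarrow>
     ('a, 'e) vfield \<Rightarrow> ('a, 'e) oneform \<Rightarrow> ('a, 'e) bilfield \<Rightarrow> bool" where
  "kenmotsu A \<phi> \<xi> \<eta> g \<longleftrightarrow> almost_contact_metric A \<phi> \<xi> \<eta> g \<and>
     (\<forall>X Y. vector_field A X \<longrightarrow> vector_field A Y \<longrightarrow> (\<forall>c\<in>A. \<forall>x\<in>crange c.
        nabla g X (apply_endo \<phi> Y) c x - apply_endo \<phi> (nabla g X Y) c x =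
        - g c x (X c x) (\<phi> c x (Y c x)) *\<^sub>R \<xi> c x - \<eta> c x (Y c x) *\<^sub>R \<phi> c x (X c x)))"

definition conf_xi :: "('a \<Rightarrow> real) \<Rightarrow> ('a, 'e::real_vector) vfield \<Rightarrow> ('a, 'e) vfield" where
  "conf_xi f \<xi> c x = exp (- (coord_fun f c x / 2)) *\<^sub>R \<xi> c x"

definition conf_eta :: "('a \<Rightarrow> real) \<Rightarrow> ('a, 'e) oneform \<Rightarrow> ('a, 'e) oneform" where
  "conf_eta f \<eta> c x u = exp (coord_fun f c x / 2) * \<eta> c x u"

definition conf_metric :: "('a \<Rightarrow> real) \<Rightarrow> ('a, 'e) bilfield \<Rightarrow> ('a, 'e) bilfield" where
  "conf_metric f g c x u v = exp (coord_fun f c x) * g c x u v"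

definition conformal_kenmotsu ::
    "('a::topological_space, 'e::euclidean_space) chart set \<Rightarrow> ('a, 'e) endofield \<Rightarrow>
     ('a, 'e) vfield \<Rightarrow> ('a, 'e) oneform \<Rightarrow> ('a, 'e) bilfield \<Rightarrow> ('a \<Rightarrow> real) \<Rightarrow> bool" where
  "conformal_kenmotsu A \<phi> \<xi> \<eta> g f \<longleftrightarrow> almost_contact_metric A \<phi> \<xi> \<eta> g \<and>
     smooth_fun A f \<and> (\<forall>p. f p > 0) \<and>
     kenmotsu A \<phi> (conf_xi f \<xi>) (conf_eta f \<eta>) (conf_metric f g)"

definition const_phi_sectional ::
    "('a, 'e::euclidean_space) chart set \<Rightarrow> ('a, 'e) endofield \<Rightarrow> ('a, 'e) vfield \<Rightarrow>
     ('a, 'e) bilfield \<Rightarrow> real \<Rightarrow> bool" where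
  "const_phi_sectional A \<phi> \<xi> g k \<longleftrightarrow>
     (\<forall>c\<in>A. \<forall>x\<in>crange c. \<forall>u. u \<noteq> 0 \<longrightarrow> g c x u (\<xi> c x) = 0 \<longrightarrow>
        sectional_curvature g c x u (\<phi> c x u) = k)"

definition conformal_kenmotsu_space_form ::
    "('a::topological_space, 'e::euclidean_space) chart set \<Rightarrow> ('a, 'e) endofield \<Rightarrow>
     ('a, 'e) vfield \<Rightarrow> ('a, 'e) oneform \<Rightarrow> ('a, 'e) bilfield \<Rightarrow> ('a \<Rightarrow> real) \<Rightarrow> real \<Rightarrow> bool" where
  "conformal_kenmotsu_space_form A \<phi> \<xi> \<eta> g f k \<longleftrightarrow> conformal_kenmotsu A \<phi> \<xi> \<eta> g f \<and>
     const_phi_sectional A \<phi> (conf_xi f \<xi>) (conf_metric f g) k"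

definition lee_form :: "('a \<Rightarrow> real) \<Rightarrow> ('a, 'e::real_normed_vector) oneform" where
  "lee_form f c x u = frechet_derivative (coord_fun f c) (at x) u"

definition sharp :: "('a, 'e) bilfield \<Rightarrow> ('a, 'e) oneform \<Rightarrow> ('a, 'e) vfield" where
  "sharp g \<theta> c x = (THE w. \<forall>v. g c x w v = \<theta> c x v)"

definition lee_vector ::
    "('a, 'e::real_normed_vector) bilfield \<Rightarrow> ('a \<Rightarrow> real) \<Rightarrow> ('a, 'e) vfield" where
  "lee_vector g f = sharp g (lee_form f)"

section \<open>CR-hypersurfaces\<close>

text \<open>Slice charts are taken from the maximal atlas determined by \<open>A\<close>.\<close>

definition embedded_submanifold ::
    "('a::topological_space, 'e::euclidean_space) chart set \<Rightarrow> nat \<Rightarrow> 'a set \<Rightarrow> bool" where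
  "embedded_submanifold A k S \<longleftrightarrow> (\<forall>p\<in>S. \<exists>c V. is_chart c \<and> (\<forall>c'\<in>A. compatible c c') \<and>
     p \<in> cdom c \<and> subspace V \<and> dim V = k \<and> cmap c ` (S \<inter> cdom c) = crange c \<inter> V)"

abbreviation coords_of :: "'a set \<Rightarrow> ('a, 'e) chart \<Rightarrow> 'e set" where
  "coords_of S c \<equiv> cmap c ` (S \<inter> cdom c)"

text \<open>Velocities of the smooth curves in \<open>S\<close> through the point with coordinates \<open>x\<close>.\<close>

definition tangent_space ::
    "'a set \<Rightarrow> ('a, 'e::euclidean_space) chart \<Rightarrow> 'e \<Rightarrow> 'e set" where
  "tangent_space S c x = {v. \<exists>\<epsilon>>0. \<exists>\<gamma>. smooth_on \<gamma> {-\<epsilon><..<\<epsilon>} \<and> \<gamma> 0 = x \<and>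
     (\<forall>t\<in>{-\<epsilon><..<\<epsilon>}. \<gamma> t \<in> coords_of S c) \<and> (\<gamma> has_vector_derivative v) (at (0::real))}"

definition normal_space :: "('a, 'e::euclidean_space) bilfield \<Rightarrow> 'a set \<Rightarrow>
    ('a, 'e) chart \<Rightarrow> 'e \<Rightarrow> 'e set" where
  "normal_space g S c x = {w. \<forall>v\<in>tangent_space S c x. g c x w v = 0}"

definition tangent_to :: "('a, 'e::euclidean_space) chart set \<Rightarrow> 'a set \<Rightarrow> ('a, 'e) vfield \<Rightarrow> bool" where
  "tangent_to A S X \<longleftrightarrow> (\<forall>c\<in>A. \<forall>x\<in>coords_of S c. X c x \<in> tangent_space S c x)"

definition local_extension ::
    "'a set \<Rightarrow> ('a, 'e::euclidean_space) vfield \<Rightarrow> ('a, 'e) chart \<Rightarrow> 'e \<Rightarrow> ('e \<Rightarrow> 'e) \<Rightarrow> bool" where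
  "local_extension S N c x F \<longleftrightarrow> (\<exists>W. open W \<and> x \<in> W \<and> W \<subseteq> crange c \<and> smooth_on F W \<and>
     (\<forall>y\<in>W \<inter> coords_of S c. F y = N c y))"

text \<open>Smooth sections of \<open>TM\<close> over \<open>S\<close>: only the values of \<open>N c\<close> on \<open>coords_of S c\<close> matter.\<close>

definition vector_field_along ::
    "('a::topological_space, 'e::euclidean_space) chart set \<Rightarrow> 'a set \<Rightarrow> ('a, 'e) vfield \<Rightarrow> bool" where
  "vector_field_along A S N \<longleftrightarrow>
     (\<forall>c\<in>A. \<forall>x\<in>coords_of S c. \<exists>F. local_extension S N c x F) \<and>
     (\<forall>c\<in>A. \<forall>c'\<in>A. \<forall>x\<in>cmap c ` (S \<inter> cdom c \<inter> cdom c').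
        N c' (transition c c' x) = jac c c' x (N c x))"

definition unit_normal_field ::
    "('a::topological_space, 'e::euclidean_space) chart set \<Rightarrow> ('a, 'e) bilfield \<Rightarrow> 'a set \<Rightarrow>
     ('a, 'e) vfield \<Rightarrow> bool" where
  "unit_normal_field A g S N \<longleftrightarrow> vector_field_along A S N \<and>
     (\<forall>c\<in>A. \<forall>x\<in>coords_of S c. N c x \<in> normal_space g S c x \<and> g c x (N c x) (N c x) = 1)"

text \<open>\<open>\<nabla>\<^sub>u N\<close> for \<open>u\<close> tangent to \<open>S\<close>, computed with any local extension of \<open>N\<close>.\<close>

definition cov_deriv_along :: "('a, 'e::euclidean_space) bilfield \<Rightarrow> 'a set \<Rightarrow> ('a, 'e) vfield \<Rightarrow>
    ('a, 'e) chart \<Rightarrow> 'e \<Rightarrow> 'e \<Rightarrow> 'e" where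
  "cov_deriv_along g S N c x u =
     (THE w. \<exists>F. local_extension S N c x F \<and> w = cov_deriv (g c) (\<lambda>_. u) F x)"

definition shape_operator :: "('a, 'e::euclidean_space) bilfield \<Rightarrow> 'a set \<Rightarrow> ('a, 'e) vfield \<Rightarrow>
    ('a, 'e) chart \<Rightarrow> 'e \<Rightarrow> 'e \<Rightarrow> 'e" where
  "shape_operator g S N c x u = - cov_deriv_along g S N c x u"

definition U_field :: "('a, 'e::euclidean_space) endofield \<Rightarrow> ('a, 'e) vfield \<Rightarrow> ('a, 'e) vfield" where
  "U_field \<phi> N c x = - \<phi> c x (N c x)"

definition D_perp :: "('a, 'e::euclidean_space) endofield \<Rightarrow> ('a, 'e) vfield \<Rightarrow> ('a, 'e) vfield \<Rightarrow>
    ('a, 'e) chart \<Rightarrow> 'e \<Rightarrow> 'e set" where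
  "D_perp \<phi> \<xi> N c x = span {U_field \<phi> N c x, \<xi> c x}"

definition D_dist :: "('a, 'e::euclidean_space) endofield \<Rightarrow> ('a, 'e) vfield \<Rightarrow> ('a, 'e) bilfield \<Rightarrow>
    'a set \<Rightarrow> ('a, 'e) vfield \<Rightarrow> ('a, 'e) chart \<Rightarrow> 'e \<Rightarrow> 'e set" where
  "D_dist \<phi> \<xi> g S N c x = {v \<in> tangent_space S c x. \<forall>w\<in>D_perp \<phi> \<xi> N c x. g c x v w = 0}"

text \<open>The two distributions are smooth because \<open>U\<close> and \<open>\<xi>\<close> are, and orthogonal by definition.\<close>

definition cr_hypersurface ::
    "('a::topological_space, 'e::euclidean_space) chart set \<Rightarrow> nat \<Rightarrow> ('a, 'e) endofield \<Rightarrow>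
     ('a, 'e) vfield \<Rightarrow> ('a, 'e) bilfield \<Rightarrow> 'a set \<Rightarrow> ('a, 'e) vfield \<Rightarrow> bool" where
  "cr_hypersurface A n \<phi> \<xi> g S N \<longleftrightarrow>
     embedded_submanifold A (2 * n) S \<and> tangent_to A S \<xi> \<and> unit_normal_field A g S N \<and>
     (\<forall>c\<in>A. \<forall>x\<in>coords_of S c.
        tangent_space S c x = {u + v |u v. u \<in> D_dist \<phi> \<xi> g S N c x \<and> v \<in> D_perp \<phi> \<xi> N c x} \<and>
        \<phi> c x ` D_dist \<phi> \<xi> g S N c x \<subseteq> D_dist \<phi> \<xi> g S N c x \<and>
        \<phi> c x ` D_perp \<phi> \<xi> N c x \<subseteq> normal_space g S c x)"

definition scalar_shape_operator ::
    "('a, 'e::euclidean_space) chart set \<Rightarrow> ('a, 'e) bilfield \<Rightarrow> 'a set \<Rightarrow> ('a, 'e) vfield \<Rightarrow> bool" where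
  "scalar_shape_operator A g S N \<longleftrightarrow> (\<exists>l :: 'a \<Rightarrow> real. \<forall>c\<in>A. \<forall>p\<in>S \<inter> cdom c.
     \<forall>u\<in>tangent_space S c (cmap c p). shape_operator g S N c (cmap c p) u = l p *\<^sub>R u)"

definition totally_geodesic ::
    "('a, 'e::euclidean_space) chart set \<Rightarrow> ('a, 'e) bilfield \<Rightarrow> 'a set \<Rightarrow> ('a, 'e) vfield \<Rightarrow> bool" where
  "totally_geodesic A g S N \<longleftrightarrow> (\<forall>c\<in>A. \<forall>p\<in>S \<inter> cdom c.
     \<forall>u\<in>tangent_space S c (cmap c p). shape_operator g S N c (cmap c p) u = 0)"

section \<open>The definite descriptions are well defined\<close>

lemma ex1_metric_dual:
  fixes B :: "'e::euclidean_space \<Rightarrow> 'e \<Rightarrow> real"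
  assumes B: "bilinear B" and pos: "\<And>v. v \<noteq> 0 \<Longrightarrow> B v v > 0" and L: "linear L"
  shows "\<exists>!w. \<forall>v. B w v = L v"
proof -
  define T where "T w = (\<Sum>b\<in>Basis. B w b *\<^sub>R b)" for w
  have lin1: "linear (\<lambda>w. B w v)" and lin2: "linear (B w)" for v w
    using B by (auto simp: bilinear_def)
  have T_in: "T w \<bullet> b = B w b" if "b \<in> Basis" for w b
    using that by (simp add: T_def inner_sum_left inner_Basis if_distrib cong: if_cong)
  have expand: "K v = (\<Sum>b\<in>Basis. (v \<bullet> b) * K b)" if "linear K" for K :: "'e \<Rightarrow> real" and v
  proof -
    have "K v = K (\<Sum>b\<in>Basis. (v \<bullet> b) *\<^sub>R b)" by (simp add: euclidean_representation)
    also have "\<dots> = (\<Sum>b\<in>Basis. (v \<bullet> b) * K b)"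
      using that by (simp add: linear_sum linear_scale)
    finally show ?thesis .
  qed
  have T_lin: "linear T"
    unfolding T_def
    by (rule linearI)
       (simp_all add: linear_add[OF lin1] linear_scale[OF lin1] scaleR_add_left sum.distrib
          scaleR_sum_right)
  have "inj T"
  proof (rule linear_injective_0[OF T_lin, THEN iffD2], intro allI impI)
    fix w assume "T w = 0"
    then have "B w b = 0" if "b \<in> Basis" for b using T_in[OF that, of w] by simp
    then have "B w w = 0" by (subst expand[OF lin2]) simp
    then show "w = 0" using pos[of w] by force
  qed
  then have "surj T" by (simp add: T_lin linear_injective_imp_surjective)
  then obtain w where w: "T w = (\<Sum>b\<in>Basis. L b *\<^sub>R b)" by (metis surjD)
  have ex: "\<forall>v. B w v = L v"
  proof
    fix v
    have "B w b = L b" if "b \<in> Basis" for b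
      using T_in[OF that, of w] that unfolding w
      by (simp add: inner_sum_left inner_Basis if_distrib cong: if_cong)
    then show "B w v = L v" by (simp add: expand[OF lin2, of w v] expand[OF L, of v])
  qed
  show ?thesis
  proof (rule ex1I)
    show "\<forall>v. B w v = L v" by (fact ex)
  next
    fix w' assume w': "\<forall>v. B w' v = L v"
    have "B (w' - w) (w' - w) = 0"
      using w' ex linear_diff[OF lin1] by simp
    then show "w' = w" using pos[of "w' - w"] by force
  qed
qed

lemma ex1_christoffel:
  fixes G :: "'e::euclidean_space \<Rightarrow> 'e \<Rightarrow> 'e \<Rightarrow> real"
  assumes W: "open W" "x \<in> W"
    and bil: "\<And>y. y \<in> W \<Longrightarrow> bilinear (G y)"
    and sym: "\<And>y u v. y \<in> W \<Longrightarrow> G y u v = G y v u"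
    and pos: "\<And>v. v \<noteq> 0 \<Longrightarrow> G x v v > 0"
    and diff: "\<And>u v. (\<lambda>y. G y u v) differentiable (at x)"
  shows "\<exists>!\<Gamma>. bilinear \<Gamma> \<and> (\<forall>u v. \<Gamma> u v = \<Gamma> v u) \<and>
     (\<forall>w u v. frechet_derivative (\<lambda>y. G y u v) (at x) w = G x (\<Gamma> w u) v + G x u (\<Gamma> w v))"
proof -
  define d where "d w u v = frechet_derivative (\<lambda>y. G y u v) (at x) w" for w u v
  have hd: "((\<lambda>y. G y u v) has_derivative (\<lambda>w. d w u v)) (at x)" for u v
    using diff[of u v] unfolding d_def frechet_derivative_works by simp
  have d_eqI: "d w u v = D w"
    if "(F has_derivative D) (at x)" "\<And>y. y \<in> W \<Longrightarrow> F y = G y u v" for F D w u v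
  proof -
    have "((\<lambda>y. G y u v) has_derivative D) (at x)"
      by (rule has_derivative_transform_within_open[OF that(1) W]) (simp add: that(2))
    with hd show ?thesis using has_derivative_unique by metis
  qed
  have lin1: "linear (\<lambda>w. G y w v)" and lin2: "linear (G y w)" if "y \<in> W" for y v w
    using bil[OF that] by (auto simp: bilinear_def)
  have d_sym: "d w u v = d w v u" for w u v
    by (rule d_eqI[OF hd]) (simp add: sym)
  have dl1: "linear (\<lambda>w. d w u v)" for u v
    using hd[of u v] has_derivative_linear by blast
  have dl3: "linear (d w u)" for w u
  proof (rule linearI)
    fix a b show "d w u (a + b) = d w u a + d w u b"
      by (rule d_eqI[OF has_derivative_add[OF hd hd]]) (simp add: linear_add[OF lin2])
  next
    fix r a show "d w u (r *\<^sub>R a) = r *\<^sub>R d w u a"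
      by (rule d_eqI[OF has_derivative_scaleR_right[OF hd]]) (simp add: linear_scale[OF lin2])
  qed
  have dl2: "linear (\<lambda>u. d w u v)" for w v
    using dl3[of w v] by (simp add: d_sym[of w _ v])
  define K where "K u v w = (d u v w + d v u w - d w u v) / 2" for u v w
  note adds = linear_add[OF dl1] linear_add[OF dl2] linear_add[OF dl3]
    linear_scale[OF dl1] linear_scale[OF dl2] linear_scale[OF dl3]
  have K3: "linear (K u v)" for u v
    unfolding K_def by (rule linearI) (simp_all add: adds field_simps)
  have K2: "linear (\<lambda>v. K u v w)" for u w
    unfolding K_def by (rule linearI) (simp_all add: adds field_simps)
  have K_sym: "K u v w = K v u w" for u v w
    unfolding K_def using d_sym[of w u v] by simp
  have dual: "\<exists>!z. \<forall>w. G x z w = K u v w" for u v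
    by (rule ex1_metric_dual[OF bil[OF W(2)] pos K3])
  define \<Gamma> where "\<Gamma> u v = (THE z. \<forall>w. G x z w = K u v w)" for u v
  have \<Gamma>: "G x (\<Gamma> u v) w = K u v w" for u v w
    using theI'[OF dual[of u v]] by (simp add: \<Gamma>_def)
  have \<Gamma>_eqI: "\<Gamma> u v = z" if "\<And>w. G x z w = K u v w" for u v z
    using dual[of u v] that \<Gamma> by metis
  have \<Gamma>_sym: "\<Gamma> u v = \<Gamma> v u" for u v
    by (rule \<Gamma>_eqI) (metis \<Gamma> K_sym)
  have \<Gamma>2: "linear (\<Gamma> u)" for u
  proof (rule linearI)
    fix a b show "\<Gamma> u (a + b) = \<Gamma> u a + \<Gamma> u b"
      by (rule \<Gamma>_eqI) (simp add: linear_add[OF lin1[OF W(2)]] \<Gamma> linear_add[OF K2])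
  next
    fix r a show "\<Gamma> u (r *\<^sub>R a) = r *\<^sub>R \<Gamma> u a"
      by (rule \<Gamma>_eqI) (simp add: linear_scale[OF lin1[OF W(2)]] \<Gamma> linear_scale[OF K2])
  qed
  have "bilinear \<Gamma>"
    unfolding bilinear_def using \<Gamma>2 by (simp add: \<Gamma>_sym[of _ v for v])
  moreover have "d w u v = G x (\<Gamma> w u) v + G x u (\<Gamma> w v)" for w u v
  proof -
    have "G x (\<Gamma> w u) v = K w u v" "G x u (\<Gamma> w v) = K w v u"
      using \<Gamma>[of w u v] \<Gamma>[of w v u] sym[OF W(2), of u "\<Gamma> w v"] by simp_all
    then show ?thesis
      using d_sym[of w v u] by (simp add: K_def field_simps)
  qed
  ultimately have ex: "bilinear \<Gamma> \<and> (\<forall>u v. \<Gamma> u v = \<Gamma> v u) \<and>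
      (\<forall>w u v. d w u v = G x (\<Gamma> w u) v + G x u (\<Gamma> w v))"
    using \<Gamma>_sym by blast
  show ?thesis
    unfolding d_def[symmetric]
  proof (rule ex1I, rule ex)
    fix H assume H: "bilinear H \<and> (\<forall>u v. H u v = H v u) \<and>
      (\<forall>w u v. d w u v = G x (H w u) v + G x u (H w v))"
    show "H = \<Gamma>"
    proof (intro ext)
      fix u v
      have "\<Gamma> u v = H u v"
      proof (rule \<Gamma>_eqI)
        fix w
        have "d u v w = G x (H u v) w + G x v (H u w)"
          "d v u w = G x (H v u) w + G x u (H v w)"
          "d w u v = G x (H w u) v + G x u (H w v)" using H by blast+
        moreover have "H v u = H u v" "H w u = H u w" "H w v = H v w" using H by blast+
        ultimately show "G x (H u v) w = K u v w"
          unfolding K_def using sym[OF W(2), of v "H u w"] by simp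
      qed
      then show "H u v = \<Gamma> u v" by simp
    qed
  qed
qed

lemma smooth_on_imp_differentiable:
  assumes "smooth_on F W" "x \<in> W"
  shows "F differentiable (at x)"
proof -
  have "times_differentiable_on (Suc 0) F W" using assms(1) by (simp add: smooth_on_def)
  then show ?thesis using assms(2) by simp
qed

lemma cov_deriv_along_eq:
  fixes c :: "('a, 'e::euclidean_space) chart"
  assumes u: "u \<in> tangent_space S c x" and F: "local_extension S N c x F"
  shows "cov_deriv_along g S N c x u = cov_deriv (g c) (\<lambda>_. u) F x"
proof -
  obtain \<epsilon> \<gamma> where \<epsilon>: "\<epsilon> > 0" and g0: "\<gamma> 0 = x"
    and in_S: "\<And>t. t \<in> {-\<epsilon><..<\<epsilon>} \<Longrightarrow> \<gamma> t \<in> coords_of S c"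
    and vd: "(\<gamma> has_vector_derivative u) (at (0::real))"
    using u by (auto simp: tangent_space_def)
  have eq: "frechet_derivative F' (at x) u = frechet_derivative F (at x) u"
    if F': "local_extension S N c x F'" for F'
  proof -
    obtain W where W: "open W" "x \<in> W" "smooth_on F W" "\<And>y. y \<in> W \<inter> coords_of S c \<Longrightarrow> F y = N c y"
      using F by (auto simp: local_extension_def)
    obtain W' where W': "open W'" "x \<in> W'" "smooth_on F' W'"
      "\<And>y. y \<in> W' \<inter> coords_of S c \<Longrightarrow> F' y = N c y"
      using F' by (auto simp: local_extension_def)
    have chain: "((\<lambda>t. H (\<gamma> t)) has_vector_derivative frechet_derivative H (at x) u) (at 0)"
      if "H differentiable (at x)" for H :: "'e \<Rightarrow> 'e"
    proof -
      have H: "(H has_derivative frechet_derivative H (at x)) (at (\<gamma> 0))"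
        using that g0 frechet_derivative_works by blast
      have "(H \<circ> \<gamma> has_derivative frechet_derivative H (at x) \<circ> (\<lambda>t. t *\<^sub>R u)) (at 0)"
        by (rule diff_chain_at[OF vd[unfolded has_vector_derivative_def] H])
      then show ?thesis
        using linear_scale[OF has_derivative_linear[OF H]]
        by (simp add: has_vector_derivative_def o_def)
    qed
    have "continuous (at 0) \<gamma>" using vd has_vector_derivative_continuous by blast
    then have "(\<gamma> \<longlongrightarrow> x) (nhds 0)"
      using g0 by (metis isCont_def tendsto_at_iff_tendsto_nhds)
    then have "eventually (\<lambda>t. \<gamma> t \<in> W \<inter> W') (nhds 0)"
      using W(1,2) W'(1,2) by (intro topological_tendstoD[of \<gamma> x]) auto
    moreover have "eventually (\<lambda>t. t \<in> {-\<epsilon><..<\<epsilon>}) (nhds (0::real))"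
      using \<epsilon> by (intro eventually_nhds_in_open) auto
    ultimately have ev: "eventually (\<lambda>t. F (\<gamma> t) = F' (\<gamma> t)) (nhds 0)"
      by eventually_elim (use W(4) W'(4) in_S in auto)
    then obtain Z where Z: "open Z" "0 \<in> Z" "\<And>t. t \<in> Z \<Longrightarrow> F (\<gamma> t) = F' (\<gamma> t)"
      by (auto simp: eventually_nhds)
    have "((\<lambda>t. F' (\<gamma> t)) has_vector_derivative frechet_derivative F (at x) u) (at 0)"
      using has_vector_derivative_transform_within_open[OF
          chain[OF smooth_on_imp_differentiable[OF W(3,2)]] Z] by simp
    with chain[OF smooth_on_imp_differentiable[OF W'(3,2)]] show ?thesis
      using vector_derivative_unique_at by blast
  qed
  have val: "F' x = F x" if F': "local_extension S N c x F'" for F'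
  proof -
    have x: "x \<in> coords_of S c" using in_S[of 0] \<epsilon> g0 by simp
    have "H x = N c x" if "local_extension S N c x H" for H
      using that x unfolding local_extension_def by blast
    then show ?thesis using F F' by metis
  qed
  show ?thesis
    unfolding cov_deriv_along_def
  proof (rule the_equality)
    show "\<exists>F'. local_extension S N c x F' \<and> cov_deriv (g c) (\<lambda>_. u) F x = cov_deriv (g c) (\<lambda>_. u) F' x"
      using F by blast
  next
    fix w assume "\<exists>F'. local_extension S N c x F' \<and> w = cov_deriv (g c) (\<lambda>_. u) F' x"
    then obtain F' where F': "local_extension S N c x F'" "w = cov_deriv (g c) (\<lambda>_. u) F' x"
      by blast
    show "w = cov_deriv (g c) (\<lambda>_. u) F x"
      unfolding F'(2) cov_deriv_def eq[OF F'(1)] val[OF F'(1)] ..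
  qed
qed

end

theory Submission
  imports Defs
begin

text \<open>
  Only the direction of \<open>\<xi>\<close> matters. The Kenmotsu identity with both arguments equal to the
  rescaled Reeb field shows that its acceleration is annihilated by \<open>\<phi>\<close>, hence is a multiple
  of \<open>\<xi>\<close>. By the conformal change of the Levi-Civita connection, \<open>\<nabla>\<^sub>\<xi> \<xi>\<close> is then a linear
  combination of \<open>\<xi>\<close> and the Lee vector field, both tangent to the hypersurface. So
  \<open>g (A \<xi>) \<xi> = g (\<nabla>\<^sub>\<xi> \<xi>) N = 0\<close>, and a scalar shape operator with this property vanishes.
\<close>

section \<open>Metrics in a chart and their Christoffel symbols\<close>

text \<open>The chart-level notion of a Riemannian metric, with the first-order regularity that
  Christoffel symbols consume. It serves both \<open>g c\<close> and its conformal multiple.\<close>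

definition local_metric :: "('e::euclidean_space \<Rightarrow> 'e \<Rightarrow> 'e \<Rightarrow> real) \<Rightarrow> 'e set \<Rightarrow> bool" where
  "local_metric G W \<longleftrightarrow> open W \<and> (\<forall>y\<in>W. bilinear (G y) \<and> (\<forall>u v. G y u v = G y v u) \<and>
     (\<forall>v. v \<noteq> 0 \<longrightarrow> G y v v > 0) \<and> (\<forall>u v. (\<lambda>z. G z u v) differentiable (at y)))"

lemma riemannian_metric_local:
  assumes "riemannian_metric A g" "c \<in> A" "is_chart c"
  shows "local_metric (g c) (crange c)"
  unfolding local_metric_def
proof (intro conjI ballI allI)
  show "open (crange c)" using assms(3) by (simp add: is_chart_def)
  have *: "\<forall>x\<in>crange c. bilinear (g c x) \<and> (\<forall>u v. g c x u v = g c x v u) \<and>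
      (\<forall>v. v \<noteq> 0 \<longrightarrow> g c x v v > 0)"
    and smooth: "\<forall>u v. smooth_on (\<lambda>x. g c x u v) (crange c)"
    using assms(1,2) unfolding riemannian_metric_def by blast+
  fix y u v assume y: "y \<in> crange c"
  show "bilinear (g c y)" "g c y u v = g c y v u" "v \<noteq> 0 \<longrightarrow> g c y v v > 0"
    using * y by blast+
  show "(\<lambda>z. g c z u v) differentiable (at y)"
    by (rule smooth_on_imp_differentiable[OF _ y]) (rule smooth[rule_format])
qed

lemma local_metricD:
  assumes "local_metric G W" "x \<in> W"
  shows "bilinear (G x)" "G x u v = G x v u" "v \<noteq> 0 \<Longrightarrow> G x v v > 0"
    "(\<lambda>y. G y u v) differentiable (at x)"
  using assms unfolding local_metric_def by simp_all

lemma christoffel_ex1: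
  assumes "local_metric G W" "x \<in> W"
  shows "\<exists>!\<Gamma>. bilinear \<Gamma> \<and> (\<forall>u v. \<Gamma> u v = \<Gamma> v u) \<and>
     (\<forall>w u v. frechet_derivative (\<lambda>y. G y u v) (at x) w = G x (\<Gamma> w u) v + G x u (\<Gamma> w v))"
proof (rule ex1_christoffel[of W])
  show "open W" "x \<in> W" using assms by (simp_all add: local_metric_def)
qed (use local_metricD[OF assms(1)] assms(2) in \<open>simp_all only: simp_thms\<close>)

lemma christoffel_works:
  assumes "local_metric G W" "x \<in> W"
  shows bilinear_christoffel: "bilinear (christoffel G x)"
    and christoffel_commute: "christoffel G x u v = christoffel G x v u"
    and frechet_derivative_metric: "frechet_derivative (\<lambda>y. G y u v) (at x) w =
      G x (christoffel G x w u) v + G x u (christoffel G x w v)"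
proof -
  note * = theI'[OF christoffel_ex1[OF assms], folded christoffel_def]
  show "bilinear (christoffel G x)"
    by (rule *[THEN conjunct1])
  show "christoffel G x u v = christoffel G x v u"
    by (rule *[THEN conjunct2, THEN conjunct1, rule_format])
  show "frechet_derivative (\<lambda>y. G y u v) (at x) w =
      G x (christoffel G x w u) v + G x u (christoffel G x w v)"
    by (rule *[THEN conjunct2, THEN conjunct2, rule_format])
qed

text \<open>Torsion-freeness and metric compatibility determine the symbols uniquely, so a guessed
  formula only has to be checked against these two conditions. The conformal change below is
  obtained in this way.\<close>

lemma christoffel_eqI:
  assumes "local_metric G W" "x \<in> W" "bilinear \<Gamma>" "\<And>u v. \<Gamma> u v = \<Gamma> v u"
    and "\<And>w u v. frechet_derivative (\<lambda>y. G y u v) (at x) w = G x (\<Gamma> w u) v + G x u (\<Gamma> w v)"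
  shows "christoffel G x = \<Gamma>"
  unfolding christoffel_def
  by (rule the1_equality[OF christoffel_ex1[OF assms(1,2)]]) (intro conjI allI assms(3-5))

section \<open>Conformal change of the Levi-Civita connection\<close>

text \<open>Here \<open>a\<close> is the gradient of \<open>F\<close> at \<open>x\<close> with
  respect to \<open>G\<close>. The correction to the old symbols is symmetric, so torsion stays
  zero, and its contribution to metric compatibility is exactly the extra term
  \<open>dF w * G x u v\<close> produced by differentiating the factor \<open>exp (F y)\<close>.
  Uniqueness of the symbols does the rest.\<close>

lemma christoffel_conformal:
  assumes G: "local_metric G W" "x \<in> W"
    and G': "local_metric (\<lambda>y u v. exp (F y) * G y u v) W"
    and F: "(F has_derivative dF) (at x)"
    and a: "\<And>v. G x a v = dF v"
  shows "christoffel (\<lambda>y u v. exp (F y) * G y u v) x u v =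
    christoffel G x u v + (1/2) *\<^sub>R (dF u *\<^sub>R v + dF v *\<^sub>R u - G x u v *\<^sub>R a)"
proof -
  note bil = local_metricD(1)[OF G] and bil\<Gamma> = bilinear_christoffel[OF G]
  note sym = local_metricD(2)[OF G]
  note lins = linear_add[OF has_derivative_linear[OF F]] linear_scale[OF has_derivative_linear[OF F]]
    bilinear_ladd[OF bil] bilinear_radd[OF bil] bilinear_lmul[OF bil] bilinear_rmul[OF bil]
    bilinear_ladd[OF bil\<Gamma>] bilinear_radd[OF bil\<Gamma>] bilinear_lmul[OF bil\<Gamma>] bilinear_rmul[OF bil\<Gamma>]
    bilinear_lsub[OF bil] bilinear_rsub[OF bil]
  define H where "H u v = christoffel G x u v +
    (1/2) *\<^sub>R (dF u *\<^sub>R v + dF v *\<^sub>R u - G x u v *\<^sub>R a)" for u v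
  have "christoffel (\<lambda>y u v. exp (F y) * G y u v) x = H"
  proof (rule christoffel_eqI[OF G' G(2)])
    \<comment> \<open>The factor \<open>1/2\<close> is generalised to \<open>h\<close>, so that the
      rewriting treats it as an opaque scalar.\<close>
    have "bilinear (\<lambda>u v. christoffel G x u v + h *\<^sub>R (dF u *\<^sub>R v + dF v *\<^sub>R u - G x u v *\<^sub>R a))" for h
      unfolding bilinear_def by (auto intro!: linearI simp: lins algebra_simps)
    from this[of "1/2"] show "bilinear H" by (simp only: H_def[abs_def])
    show "H u v = H v u" for u v
      using christoffel_commute[OF G, of u v] sym[of u v] by (simp add: H_def)
    fix w u v
    have GH: "G x (H w u) v = G x (christoffel G x w u) v +
      (dF w * G x u v + dF u * G x w v - G x w u * dF v) / 2" for w u v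
      by (simp add: H_def lins a)
    have dG: "((\<lambda>y. G y u v) has_derivative frechet_derivative (\<lambda>y. G y u v) (at x)) (at x)"
      by (rule local_metricD(4)[OF G, unfolded frechet_derivative_works])
    have "((\<lambda>y. exp (F y) * G y u v) has_derivative
      (\<lambda>w. exp (F x) * frechet_derivative (\<lambda>y. G y u v) (at x) w + exp (F x) * dF w * G x u v)) (at x)"
      by (rule has_derivative_eq_rhs[OF has_derivative_mult[OF has_derivative_exp[OF F] dG]])
         (simp add: fun_eq_iff)
    then have "frechet_derivative (\<lambda>y. exp (F y) * G y u v) (at x) =
      (\<lambda>w. exp (F x) * frechet_derivative (\<lambda>y. G y u v) (at x) w + exp (F x) * dF w * G x u v)"
      by (rule frechet_derivative_at[symmetric])
    then have "frechet_derivative (\<lambda>y. exp (F y) * G y u v) (at x) w =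
      exp (F x) * (G x (christoffel G x w u) v + G x (christoffel G x w v) u + dF w * G x u v)"
      by (simp only: frechet_derivative_metric[OF G] sym[of u "christoffel G x w v"] distrib_left
          mult.assoc)
    \<comment> \<open>Exchanging \<open>u\<close> and \<open>v\<close> changes the sign of the last
      two correction terms in \<open>GH\<close>. They cancel in the sum, and the two halves of
      \<open>dF w * G x u v\<close> add up.\<close>
    also have "\<dots> = exp (F x) * (G x (H w u) v + G x (H w v) u)"
      unfolding GH sym[of v u] by (simp add: field_simps)
    finally show "frechet_derivative (\<lambda>y. exp (F y) * G y u v) (at x) w =
      exp (F x) * G x (H w u) v + exp (F x) * G x u (H w v)"
      by (simp only: sym[of u "H w v"] distrib_left)
  qed
  then show ?thesis by (simp add: H_def)
qed

section \<open>Metric compatibility along curves and the Weingarten formula\<close>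

text \<open>Differentiability of the metric is only known for fixed vector arguments. The pairing is
  therefore expanded in a basis, where every summand is a product of three differentiable scalars,
  and after the product rule the sums are folded back.\<close>

lemma has_derivative_metric:
  assumes G: "local_metric G W" "x \<in> W"
    and X: "(X has_derivative dX) (at x)" and Y: "(Y has_derivative dY) (at x)"
  shows "((\<lambda>y. G y (X y) (Y y)) has_derivative
    (\<lambda>w. G x (dX w + christoffel G x w (X x)) (Y x) +
         G x (X x) (dY w + christoffel G x w (Y x)))) (at x)"
proof -
  have expand: "B u v = (\<Sum>i\<in>Basis. \<Sum>j\<in>Basis. (u \<bullet> i) * (v \<bullet> j) * B i j)"
    if "bilinear B" for B :: "'a \<Rightarrow> 'a \<Rightarrow> real" and u v
  proof -
    have "B u v = B (\<Sum>i\<in>Basis. (u \<bullet> i) *\<^sub>R i) (\<Sum>j\<in>Basis. (v \<bullet> j) *\<^sub>R j)"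
      by (simp add: euclidean_representation)
    also have "\<dots> = (\<Sum>(i, j)\<in>Basis \<times> Basis. B ((u \<bullet> i) *\<^sub>R i) ((v \<bullet> j) *\<^sub>R j))"
      by (rule bilinear_sum[OF that])
    also have "\<dots> = (\<Sum>i\<in>Basis. \<Sum>j\<in>Basis. B ((u \<bullet> i) *\<^sub>R i) ((v \<bullet> j) *\<^sub>R j))"
      by (rule sum.cartesian_product[symmetric])
    also have "\<dots> = (\<Sum>i\<in>Basis. \<Sum>j\<in>Basis. (u \<bullet> i) * (v \<bullet> j) * B i j)"
      by (intro sum.cong refl) (simp add: bilinear_lmul[OF that] bilinear_rmul[OF that])
    finally show ?thesis .
  qed
  note bil = local_metricD(1)[OF G]
  \<comment> \<open>The derivative of the metric with frozen arguments, written through the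
    Christoffel symbols: in this form it is visibly bilinear, and it merges with \<open>dX\<close>
    and \<open>dY\<close> into covariant derivatives.\<close>
  define dG where "dG w u v = G x (christoffel G x w u) v + G x u (christoffel G x w v)" for w u v
  have dG: "((\<lambda>y. G y u v) has_derivative (\<lambda>w. dG w u v)) (at x)" for u v
  proof -
    have "frechet_derivative (\<lambda>y. G y u v) (at x) = (\<lambda>w. dG w u v)"
      unfolding dG_def by (rule ext) (rule frechet_derivative_metric[OF G])
    then show ?thesis
      using local_metricD(4)[OF G, of u v] by (metis frechet_derivative_works)
  qed
  have bil_dG: "bilinear (dG w)" for w
    unfolding dG_def bilinear_def
    by (auto intro!: linearI simp: bilinear_ladd[OF bil] bilinear_radd[OF bil] bilinear_lmul[OF bil]
        bilinear_rmul[OF bil] bilinear_radd[OF bilinear_christoffel[OF G]]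
        bilinear_rmul[OF bilinear_christoffel[OF G]] algebra_simps)
  have "((\<lambda>y. (X y \<bullet> i) * (Y y \<bullet> j) * G y i j) has_derivative
    (\<lambda>w. (dX w \<bullet> i) * (Y x \<bullet> j) * G x i j
       + (X x \<bullet> i) * (dY w \<bullet> j) * G x i j + (X x \<bullet> i) * (Y x \<bullet> j) * dG w i j)) (at x)" for i j
    by (rule has_derivative_eq_rhs[OF has_derivative_mult[OF has_derivative_mult[OF
        has_derivative_inner_left[OF X] has_derivative_inner_left[OF Y]] dG]])
       (simp add: fun_eq_iff algebra_simps)
  then have "((\<lambda>y. \<Sum>i\<in>Basis. \<Sum>j\<in>Basis. (X y \<bullet> i) * (Y y \<bullet> j) * G y i j) has_derivative
    (\<lambda>w. \<Sum>i\<in>Basis. \<Sum>j\<in>Basis. (dX w \<bullet> i) * (Y x \<bullet> j) * G x i j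
       + (X x \<bullet> i) * (dY w \<bullet> j) * G x i j + (X x \<bullet> i) * (Y x \<bullet> j) * dG w i j)) (at x)"
    by (intro has_derivative_sum)
  then have "((\<lambda>y. \<Sum>i\<in>Basis. \<Sum>j\<in>Basis. (X y \<bullet> i) * (Y y \<bullet> j) * G y i j) has_derivative
    (\<lambda>w. G x (dX w) (Y x) + G x (X x) (dY w) + dG w (X x) (Y x))) (at x)"
    by (simp only: sum.distrib expand[OF bil, symmetric] expand[OF bil_dG, symmetric])
  then have "((\<lambda>y. \<Sum>i\<in>Basis. \<Sum>j\<in>Basis. (X y \<bullet> i) * (Y y \<bullet> j) * G y i j) has_derivative
    (\<lambda>w. G x (dX w + christoffel G x w (X x)) (Y x) +
         G x (X x) (dY w + christoffel G x w (Y x)))) (at x)"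
    by (rule has_derivative_eq_rhs)
       (simp add: fun_eq_iff dG_def bilinear_ladd[OF bil] bilinear_radd[OF bil])
  \<comment> \<open>The basis expansion is valid wherever the metric is bilinear, that is on the
    open set \<open>W\<close> around \<open>x\<close>, which suffices to transfer the
    derivative.\<close>
  then show ?thesis
  proof (rule has_derivative_transform_within_open[OF _ _ G(2)])
    show "open W" using G(1) by (simp add: local_metric_def)
    show "(\<Sum>i\<in>Basis. \<Sum>j\<in>Basis. (X y \<bullet> i) * (Y y \<bullet> j) * G y i j) = G y (X y) (Y y)"
      if "y \<in> W" for y
      by (rule expand[symmetric]) (rule local_metricD(1)[OF G(1) that])
  qed
qed

text \<open>By the chain rule. It is meant for functions that vanish on the hypersurface but not
  around it: tangent vectors are velocities of curves in the hypersurface, so only the derivative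
  along such curves is controlled.\<close>

lemma has_derivative_0_along_curve:
  fixes \<gamma> :: "real \<Rightarrow> 'e::real_normed_vector" and h :: "'e \<Rightarrow> real"
  assumes h: "(h has_derivative dh) (at (\<gamma> 0))"
    and \<gamma>: "(\<gamma> has_vector_derivative v) (at 0)"
    and zero: "eventually (\<lambda>t. h (\<gamma> t) = 0) (nhds 0)"
  shows "dh v = 0"
proof -
  have "(h \<circ> \<gamma> has_derivative dh \<circ> (\<lambda>t. t *\<^sub>R v)) (at 0)"
    by (rule diff_chain_at[OF \<gamma>[unfolded has_vector_derivative_def] h])
  moreover obtain Z where "open Z" "0 \<in> Z" "\<And>t. t \<in> Z \<Longrightarrow> h (\<gamma> t) = 0"
    using zero by (auto simp: eventually_nhds)
  ultimately have "((\<lambda>_. 0) has_derivative dh \<circ> (\<lambda>t. t *\<^sub>R v)) (at 0)"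
    by (auto elim!: has_derivative_transform_within_open)
  then have "dh \<circ> (\<lambda>t. t *\<^sub>R v) = (\<lambda>_. 0)"
    by (rule has_derivative_unique[OF _ has_derivative_const])
  then show ?thesis by (metis comp_apply scaleR_one)
qed

text \<open>The Weingarten formula \<open>g (\<nabla>\<^sub>v X) N = g X (A v)\<close>:
  differentiate \<open>g X N = 0\<close> along a curve in \<open>S\<close> with velocity
  \<open>v\<close>. As \<open>N\<close> is only meaningful on \<open>S\<close>, a local extension
  \<open>F\<close> is differentiated in its place.\<close>

lemma metric_normal_cov_deriv:
  assumes G: "local_metric (g c) (crange c)"
    and X: "smooth_on (X c) (crange c)" and v: "v \<in> tangent_space S c x"
    and orth: "\<And>y. y \<in> coords_of S c \<Longrightarrow> g c y (X c y) (N c y) = 0"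
    and ext: "local_extension S N c x F"
  shows "g c x (frechet_derivative (X c) (at x) v + christoffel (g c) x v (X c x)) (N c x) =
    g c x (X c x) (shape_operator g S N c x v)"
proof -
  obtain \<epsilon> \<gamma> where \<epsilon>: "\<epsilon> > 0" and g0: "\<gamma> 0 = x"
    and in_S: "\<And>t. t \<in> {-\<epsilon><..<\<epsilon>} \<Longrightarrow> \<gamma> t \<in> coords_of S c"
    and vd: "(\<gamma> has_vector_derivative v) (at (0::real))"
    using v by (auto simp: tangent_space_def)
  have xS: "x \<in> coords_of S c" using in_S[of 0] \<epsilon> g0 by simp
  then have x: "x \<in> crange c" by auto
  obtain W where W: "open W" "x \<in> W" "smooth_on F W" "\<And>y. y \<in> W \<inter> coords_of S c \<Longrightarrow> F y = N c y"
    using ext by (auto simp: local_extension_def)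
  note dX = smooth_on_imp_differentiable[OF X x, unfolded frechet_derivative_works]
    and dF = smooth_on_imp_differentiable[OF W(3,2), unfolded frechet_derivative_works]
  have Fx: "F x = N c x" using W xS by blast
  have "(\<gamma> \<longlongrightarrow> x) (nhds 0)"
    using has_vector_derivative_continuous[OF vd] g0 by (metis isCont_def tendsto_at_iff_tendsto_nhds)
  then have "eventually (\<lambda>t. \<gamma> t \<in> W) (nhds 0)"
    using W by (intro topological_tendstoD[of \<gamma> x]) auto
  moreover have "eventually (\<lambda>t. t \<in> {-\<epsilon><..<\<epsilon>}) (nhds (0::real))"
    using \<epsilon> by (intro eventually_nhds_in_open) auto
  \<comment> \<open>\<open>F\<close> agrees with \<open>N\<close> only on the part of
    \<open>S\<close> inside \<open>W\<close>, so the orthogonality is available for small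
    \<open>t\<close>.\<close>
  ultimately have ev: "eventually (\<lambda>t. g c (\<gamma> t) (X c (\<gamma> t)) (F (\<gamma> t)) = 0) (nhds 0)"
    by eventually_elim (use W(4) in_S orth in auto)
  have "g c x (frechet_derivative (X c) (at x) v + christoffel (g c) x v (X c x)) (F x) +
    g c x (X c x) (frechet_derivative F (at x) v + christoffel (g c) x v (F x)) = 0"
    by (rule has_derivative_0_along_curve[OF _ vd ev, unfolded g0])
       (rule has_derivative_metric[OF G x dX dF])
  then show ?thesis
    using bilinear_radd[OF local_metricD(1)[OF G x]] bilinear_rsub[OF local_metricD(1)[OF G x]]
      bilinear_rneg[OF local_metricD(1)[OF G x]]
    by (simp add: shape_operator_def cov_deriv_along_eq[OF v ext] cov_deriv_def Fx)
qed

section \<open>The acceleration of the Reeb field\<close>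

lemma sharp_works:
  assumes "local_metric (g c) (crange c)" "x \<in> crange c" "linear (\<theta> c x)"
  shows "g c x (sharp g \<theta> c x) v = \<theta> c x v"
proof -
  have "\<exists>!w. \<forall>v. g c x w v = \<theta> c x v"
    by (rule ex1_metric_dual) (use local_metricD[OF assms(1,2)] assms(3) in auto)
  from theI'[OF this] show ?thesis by (simp add: sharp_def)
qed

lemma almost_contact_metricD:
  assumes "almost_contact_metric A \<phi> \<xi> \<eta> g"
  shows "endo_field A \<phi>" "vector_field A \<xi>" "riemannian_metric A g"
    and "c \<in> A \<Longrightarrow> x \<in> crange c \<Longrightarrow> \<phi> c x (\<phi> c x u) = - u + \<eta> c x u *\<^sub>R \<xi> c x"
    and "c \<in> A \<Longrightarrow> x \<in> crange c \<Longrightarrow> \<phi> c x (\<xi> c x) = 0"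
    and "c \<in> A \<Longrightarrow> x \<in> crange c \<Longrightarrow> g c x (\<xi> c x) (\<xi> c x) = 1"
  using assms unfolding almost_contact_metric_def by metis+

text \<open>Since \<open>\<phi> \<xi> = 0\<close>, the right-hand side of the Kenmotsu identity
  vanishes for \<open>X = Y = \<xi>\<close>, and so does the derivative of
  \<open>\<phi> \<xi>\<close> on the left. This leaves
  \<open>\<phi> (\<nabla>\<^sub>\<xi> \<xi>) = 0\<close>; a second application of
  \<open>\<phi>\<close> and the formula for its square give the claim.\<close>

lemma kenmotsu_acceleration:
  assumes K: "kenmotsu A \<phi> \<xi> \<eta> g" and c: "c \<in> A" "is_chart c" and x: "x \<in> crange c"
  shows "nabla g \<xi> \<xi> c x = \<eta> c x (nabla g \<xi> \<xi> c x) *\<^sub>R \<xi> c x"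
proof -
  from K have acm: "almost_contact_metric A \<phi> \<xi> \<eta> g"
    unfolding kenmotsu_def by blast
  note en = almost_contact_metricD(1)[OF acm] and vf = almost_contact_metricD(2)[OF acm]
    and rm = almost_contact_metricD(3)[OF acm] and \<phi>\<xi> = almost_contact_metricD(5)[OF acm c(1)]
  note G = riemannian_metric_local[OF rm c]
  \<comment> \<open>\<open>\<phi> \<xi>\<close> vanishes on the whole open chart range, so its
    derivative at \<open>x\<close> vanishes as well; outside that range the representatives are
    arbitrary.\<close>
  have "((\<lambda>y. \<phi> c y (\<xi> c y)) has_derivative (\<lambda>_. 0)) (at x)"
    by (rule has_derivative_transform_within_open[OF has_derivative_const[of 0]])
       (use c x \<phi>\<xi> in \<open>auto simp: is_chart_def\<close>)
  then have "frechet_derivative (\<lambda>y. \<phi> c y (\<xi> c y)) (at x) = (\<lambda>_. 0)"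
    by (rule frechet_derivative_at[symmetric])
  moreover have "apply_endo \<phi> \<xi> c = (\<lambda>y. \<phi> c y (\<xi> c y))"
    by (simp add: apply_endo_def fun_eq_iff)
  ultimately have "nabla g \<xi> (apply_endo \<phi> \<xi>) c x = 0"
    using bilinear_rzero[OF bilinear_christoffel[OF G x]]
    by (simp add: nabla_def cov_deriv_def \<phi>\<xi>[OF x])
  moreover have "nabla g \<xi> (apply_endo \<phi> \<xi>) c x - apply_endo \<phi> (nabla g \<xi> \<xi>) c x =
        - g c x (\<xi> c x) (\<phi> c x (\<xi> c x)) *\<^sub>R \<xi> c x - \<eta> c x (\<xi> c x) *\<^sub>R \<phi> c x (\<xi> c x)"
    using K vf c(1) x unfolding kenmotsu_def by blast
  ultimately have "\<phi> c x (nabla g \<xi> \<xi> c x) = 0"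
    using bilinear_rzero[OF local_metricD(1)[OF G x]]
    by (simp add: apply_endo_def \<phi>\<xi>[OF x])
  moreover have "\<phi> c x 0 = 0"
    using en c(1) x unfolding endo_field_def by (blast intro: linear_0)
  moreover have "\<phi> c x (\<phi> c x (nabla g \<xi> \<xi> c x)) =
    - nabla g \<xi> \<xi> c x + \<eta> c x (nabla g \<xi> \<xi> c x) *\<^sub>R \<xi> c x"
    by (rule almost_contact_metricD(4)[OF acm c(1) x])
  ultimately show ?thesis by simp
qed

text \<open>The acceleration of the rescaled Reeb field is computed from the connection of
  \<open>g\<close> and compared with the multiple of \<xi> given by the Kenmotsu structure. The Lee
  vector enters as the gradient term of the conformal change.\<close>

lemma conformal_kenmotsu_acceleration:
  assumes K: "conformal_kenmotsu A \<phi> \<xi> \<eta> g f" and c: "c \<in> A" "is_chart c" and x: "x \<in> crange c"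
  obtains a where "nabla g \<xi> \<xi> c x = a *\<^sub>R \<xi> c x + (1/2) *\<^sub>R lee_vector g f c x"
proof -
  let ?F = "coord_fun f c" and ?\<xi> = "conf_xi f \<xi>" and ?g = "conf_metric f g"
  define dF where "dF = frechet_derivative ?F (at x)"
  define d\<xi> where "d\<xi> = frechet_derivative (\<xi> c) (at x)"
  define s where "s = exp (- (?F x / 2))"
  from K have acm: "almost_contact_metric A \<phi> \<xi> \<eta> g"
    and ken: "kenmotsu A \<phi> ?\<xi> (conf_eta f \<eta>) ?g" and sf: "smooth_fun A f"
    by (auto simp: conformal_kenmotsu_def)
  from ken have rm': "riemannian_metric A ?g"
    unfolding kenmotsu_def by (blast dest: almost_contact_metricD(3))
  note rm = almost_contact_metricD(3)[OF acm] and unit = almost_contact_metricD(6)[OF acm c(1) x]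
  have sm\<xi>: "smooth_on (\<xi> c) (crange c)"
    using almost_contact_metricD(2)[OF acm] c by (auto simp: vector_field_def)
  note G = riemannian_metric_local[OF rm c]
  have g'_eq: "?g c = (\<lambda>y u v. exp (?F y) * g c y u v)"
    by (simp add: conf_metric_def fun_eq_iff)
  have G': "local_metric (\<lambda>y u v. exp (?F y) * g c y u v) (crange c)"
    using riemannian_metric_local[OF rm' c] by (simp add: g'_eq)
  have hF: "(?F has_derivative dF) (at x)"
    unfolding dF_def frechet_derivative_works[symmetric]
    by (rule smooth_on_imp_differentiable[OF _ x]) (use sf c(1) in \<open>simp add: smooth_fun_def\<close>)
  have h\<xi>: "(\<xi> c has_derivative d\<xi>) (at x)"
    using smooth_on_imp_differentiable[OF sm\<xi> x] unfolding d\<xi>_def frechet_derivative_works .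
  \<comment> \<open>The Lee vector is the gradient \<open>a\<close> required by
    \<open>christoffel_conformal\<close>.\<close>
  have lee: "g c x (lee_vector g f c x) v = dF v" for v
  proof -
    have lf: "lee_form f c x = dF" by (simp add: lee_form_def dF_def fun_eq_iff)
    then show ?thesis
      using sharp_works[of g c x "lee_form f" v] G x has_derivative_linear[OF hF]
      by (simp only: lee_vector_def lf)
  qed
  have \<xi>'_eq: "?\<xi> c = (\<lambda>y. exp (- (?F y / 2)) *\<^sub>R \<xi> c y)"
    by (simp add: conf_xi_def fun_eq_iff)
  have d\<xi>': "frechet_derivative (?\<xi> c) (at x) =
    (\<lambda>v. s *\<^sub>R d\<xi> v - (s * dF v / 2) *\<^sub>R \<xi> c x)"
    unfolding \<xi>'_eq s_def
    by (rule frechet_derivative_at[symmetric])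
       (auto intro!: derivative_eq_intros hF h\<xi>)
  note lins = linear_scale[OF has_derivative_linear[OF hF]]
    linear_scale[OF has_derivative_linear[OF h\<xi>]]
    bilinear_lmul[OF bilinear_christoffel[OF G x]] bilinear_rmul[OF bilinear_christoffel[OF G x]]
    bilinear_lmul[OF local_metricD(1)[OF G x]] bilinear_rmul[OF local_metricD(1)[OF G x]]
  \<comment> \<open>With \<open>?\<xi> = s \<xi>\<close>, the conformal change contributes
    \<open>dF \<xi>\<close> times \<xi> minus half the Lee vector, where
    \<open>g \<xi> \<xi> = 1\<close> is used. Differentiating \<open>s\<close> contributes minus
    half of \<open>dF \<xi>\<close> times \<xi>, so half of that multiple remains.\<close>
  have "nabla ?g ?\<xi> ?\<xi> c x =
    s\<^sup>2 *\<^sub>R (nabla g \<xi> \<xi> c x + (dF (\<xi> c x) / 2) *\<^sub>R \<xi> c x - (1/2) *\<^sub>R lee_vector g f c x)"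
    by (simp add: nabla_def cov_deriv_def d\<xi>' g'_eq christoffel_conformal[OF G x G' hF lee] lins unit
        conf_xi_def flip: s_def d\<xi>_def) (simp add: algebra_simps power2_eq_square flip: scaleR_add_left)
  moreover have "nabla ?g ?\<xi> ?\<xi> c x =
    (conf_eta f \<eta> c x (nabla ?g ?\<xi> ?\<xi> c x) * s) *\<^sub>R \<xi> c x"
    using kenmotsu_acceleration[OF ken c x] by (simp add: conf_xi_def s_def)
  ultimately obtain b where
    "s\<^sup>2 *\<^sub>R (nabla g \<xi> \<xi> c x + (dF (\<xi> c x) / 2) *\<^sub>R \<xi> c x - (1/2) *\<^sub>R lee_vector g f c x)
      = b *\<^sub>R \<xi> c x" by metis
  \<comment> \<open>The factor \<open>s\<close>, being an exponential, is nonzero and can be divided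
    out.\<close>
  then have "inverse (s\<^sup>2) *\<^sub>R s\<^sup>2 *\<^sub>R (nabla g \<xi> \<xi> c x + (dF (\<xi> c x) / 2) *\<^sub>R \<xi> c x
      - (1/2) *\<^sub>R lee_vector g f c x) = inverse (s\<^sup>2) *\<^sub>R b *\<^sub>R \<xi> c x" by simp
  then have "nabla g \<xi> \<xi> c x =
    (inverse (s\<^sup>2) * b - dF (\<xi> c x) / 2) *\<^sub>R \<xi> c x + (1/2) *\<^sub>R lee_vector g f c x"
    by (simp add: s_def algebra_simps)
  then show thesis by (rule that)
qed

section \<open>Vanishing of the scalar shape operator\<close>

theorem theorem5p3:
  fixes A :: "('a::{t2_space,second_countable_topology}, 'e::euclidean_space) chart set"
    and \<phi> :: "('a, 'e) endofield" and \<xi> :: "('a, 'e) vfield" and \<eta> :: "('a, 'e) oneform"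
    and g :: "('a, 'e) bilfield" and f :: "'a \<Rightarrow> real" and k :: real and n :: nat
    and S :: "'a set" and N :: "('a, 'e) vfield"
  assumes "smooth_atlas A" and "DIM('e) = 2 * n + 1"
    and "conformal_kenmotsu_space_form A \<phi> \<xi> \<eta> g f k"
    and "cr_hypersurface A n \<phi> \<xi> g S N"
    and "scalar_shape_operator A g S N"
    and "tangent_to A S (lee_vector g f)"
  shows "totally_geodesic A g S N"
proof -
  from assms(3) have K: "conformal_kenmotsu A \<phi> \<xi> \<eta> g f"
    by (simp add: conformal_kenmotsu_space_form_def)
  then have acm: "almost_contact_metric A \<phi> \<xi> \<eta> g" by (simp add: conformal_kenmotsu_def)
  from assms(4) have \<xi>_tan: "tangent_to A S \<xi>" and N: "unit_normal_field A g S N"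
    by (auto simp: cr_hypersurface_def)
  obtain l where l: "\<And>c p u. c \<in> A \<Longrightarrow> p \<in> S \<inter> cdom c \<Longrightarrow> u \<in> tangent_space S c (cmap c p) \<Longrightarrow>
    shape_operator g S N c (cmap c p) u = l p *\<^sub>R u"
    using assms(5) by (auto simp: scalar_shape_operator_def)
  have l0: "l p = 0" if c: "c \<in> A" and p: "p \<in> S \<inter> cdom c" for c p
  proof -
    define x where "x = cmap c p"
    have xS: "x \<in> coords_of S c" and x: "x \<in> crange c" using p by (auto simp: x_def)
    have chart: "is_chart c" using assms(1) c by (auto simp: smooth_atlas_def)
    have sm\<xi>: "smooth_on (\<xi> c) (crange c)"
      using almost_contact_metricD(2)[OF acm] c by (auto simp: vector_field_def)
    note G = riemannian_metric_local[OF almost_contact_metricD(3)[OF acm] c chart]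
    note bil = local_metricD(1)[OF G x]
    have \<xi>x: "\<xi> c x \<in> tangent_space S c x"
      using \<xi>_tan c xS by (auto simp: tangent_to_def)
    \<comment> \<open>\<open>normal_space\<close> has the normal vector in the first slot, hence the
      use of symmetry.\<close>
    have orth: "g c y v (N c y) = 0" if "y \<in> coords_of S c" "v \<in> tangent_space S c y" for y v
    proof -
      have "y \<in> crange c" using that by auto
      then show ?thesis
        using N c that local_metricD(2)[OF G, of y v "N c y"]
        by (auto simp: unit_normal_field_def normal_space_def)
    qed
    obtain F where F: "local_extension S N c x F"
      using N c xS unfolding unit_normal_field_def vector_field_along_def by blast
    have "g c y (\<xi> c y) (N c y) = 0" if "y \<in> coords_of S c" for y
      using orth[OF that] \<xi>_tan c that unfolding tangent_to_def by blast
    \<comment> \<open>The Weingarten formula with both the field and the direction equal to \<xi>,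
      which is tangent to \<open>S\<close> and therefore orthogonal to \<open>N\<close> all along
      \<open>S\<close>.\<close>
    from metric_normal_cov_deriv[of g c \<xi> "\<xi> c x" S x N F, OF G sm\<xi> \<xi>x this F]
    have "g c x (\<xi> c x) (shape_operator g S N c x (\<xi> c x)) = g c x (nabla g \<xi> \<xi> c x) (N c x)"
      by (simp only: nabla_def cov_deriv_def)
    moreover obtain a where "nabla g \<xi> \<xi> c x = a *\<^sub>R \<xi> c x + (1/2) *\<^sub>R lee_vector g f c x"
      using conformal_kenmotsu_acceleration[OF K c chart x] .
    moreover have "lee_vector g f c x \<in> tangent_space S c x"
      using assms(6) c xS by (auto simp: tangent_to_def)
    \<comment> \<open>Both summands of the acceleration are tangent to \<open>S\<close>, so its
      pairing with \<open>N\<close> is zero.\<close>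
    ultimately have "g c x (\<xi> c x) (shape_operator g S N c x (\<xi> c x)) = 0"
      using orth[OF xS] \<xi>x
      by (simp add: bilinear_ladd[OF bil] bilinear_lmul[OF bil])
    moreover have "g c x (\<xi> c x) (\<xi> c x) = 1"
      by (rule almost_contact_metricD(6)[OF acm c x])
    \<comment> \<open>As \<open>A \<xi> = l p \<xi>\<close> and \<xi> has unit length, the vanishing
      quantity is \<open>l p\<close> itself.\<close>
    ultimately show ?thesis
      using l[OF c p] \<xi>x by (simp add: bilinear_rmul[OF bil] flip: x_def)
  qed
  show ?thesis
    unfolding totally_geodesic_def using l l0 by auto
qed

end
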